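(* Let $Q\in P(N)$ and let $A,B$ be arbitrary $N\times N$ matrices. Put $$U=\frac{A-B+I}{\sqrt 2},\qquad V=\frac{A+B+I}{\sqrt 2},\qquad W=B-I.$$ Suppose that there exists $(\widetilde{Q},M)\in P(N)\times P(N)$ such that (a) $2(U\widetilde{Q}U^*+B\widetilde{Q}B^* )<\widetilde{Q}$; (b) $2(V\widetilde{Q}V^*+W\widetilde{Q}W^* )<\widetilde{Q}$; (c) $U^*MU+B^*MB<M-(V^*MV+W^*MW)$; (d) $Q\in\, ]U^*MU+B^*MB,\; M-(V^*MV+W^*MW)[$. Then: (i) The equation $A^*XB+B^*XA=-Q$ has one and only one solution $\widehat{X}\in P(N)$. (ii) $\widehat{X}\in [Q-(U^*MU+B^*MB),\;Q+(V^*MV+W^*MW)]$. (iii) Let $(X_n)_{n\ge 0}$ and $(Y_n)_{n\ge 0}$ be the sequences defined by $X_0=0$, $Y_0=M$ and $$X_{n+1}=Q+(V^*X_nV+W^*X_nW)-(U^*Y_nU+B^*Y_nB),$$ $$Y_{n+1}=Q+(V^*Y_nV+W^*Y_nW)-(U^*X_nU+B^*X_nB).$$ Then $$\lim_{n\to\infty}\|X_n-\widehat{X}\|=\lim_{n\to\infty}\|Y_n-\widehat{X}\|=0,$$ and there exists $\delta$ with $0<\delta<1$ such that, for all $n$, $$\max\{\|X_n-\widehat{X}\|,\|Y_n-\widehat{X}\|\}\le \frac{\delta^n}{1-\delta}\max\{\|X_1-X_0\|,\|Y_1-Y_0\|\}.$$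
   Context: All matrices are $N\times N$ complex matrices; $I$ is the identity matrix and $A^*$ is the conjugate transpose of $A$. $H(N)$ is the set of $N\times N$ Hermitian matrices and $P(N)\subset H(N)$ is the set of $N\times N$ Hermitian positive definite matrices. For Hermitian $X,Y$, $X\ge Y$ (resp. $X>Y$) means that $X-Y$ is positive semidefinite (resp. positive definite). For $X\le Y$ in $H(N)$, $[X,Y]=\{Z\in H(N): X\le Z\le Y\}$; for $X<Y$ in $H(N)$, $]X,Y[\,=\{Z\in H(N): X<Z<Y\}$. $\|\cdot\|$ is the spectral norm, $\|A\|=\sqrt{\lambda^+(A^*A)}$, where $\lambda^+(A^*A)$ is the largest eigenvalue of $A^*A$. *)

theory Defs
  imports "HOL-Analysis.Analysis"
begin

text \<open>
  Square complex matrices are elements of \<open>complex^'n^'n\<close>. The matrix product is \<open>**\<close> and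
  the identity is \<open>mat 1\<close>; the overloaded \<open>*\<close> and \<open>1\<close> on this type are componentwise.
\<close>

definition conj_transpose :: "complex^'n^'m \<Rightarrow> complex^'m^'n"  ("_\<^sup>\<dagger>" [1000] 1000)
  where "A\<^sup>\<dagger> = map_matrix cnj (transpose A)"

definition hermitian :: "complex^'n^'n \<Rightarrow> bool"
  where "hermitian A \<longleftrightarrow> A\<^sup>\<dagger> = A"

text \<open>The form \<open>x\<^sup>* A x\<close>. It is real whenever \<open>A\<close> is Hermitian, which is why taking the real
  part in the next two definitions loses nothing.\<close>
definition quad_form :: "complex^'n^'n \<Rightarrow> complex^'n \<Rightarrow> complex"
  where "quad_form A x = (\<Sum>i\<in>UNIV. cnj (x $ i) * (A *v x) $ i)"

definition pos_semidef :: "complex^'n^'n \<Rightarrow> bool"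
  where "pos_semidef A \<longleftrightarrow> hermitian A \<and> (\<forall>x. 0 \<le> Re (quad_form A x))"

definition pos_def :: "complex^'n^'n \<Rightarrow> bool"
  where "pos_def A \<longleftrightarrow> hermitian A \<and> (\<forall>x. x \<noteq> 0 \<longrightarrow> 0 < Re (quad_form A x))"

definition loewner_le :: "complex^'n^'n \<Rightarrow> complex^'n^'n \<Rightarrow> bool"  (infix "\<preceq>" 50)
  where "X \<preceq> Y \<longleftrightarrow> hermitian X \<and> hermitian Y \<and> pos_semidef (Y - X)"

definition loewner_less :: "complex^'n^'n \<Rightarrow> complex^'n^'n \<Rightarrow> bool"  (infix "\<prec>" 50)
  where "X \<prec> Y \<longleftrightarrow> hermitian X \<and> hermitian Y \<and> pos_def (Y - X)"

definition loewner_cinterval :: "complex^'n^'n \<Rightarrow> complex^'n^'n \<Rightarrow> (complex^'n^'n) set"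
  where "loewner_cinterval X Y = {Z. hermitian Z \<and> X \<preceq> Z \<and> Z \<preceq> Y}"

definition loewner_ointerval :: "complex^'n^'n \<Rightarrow> complex^'n^'n \<Rightarrow> (complex^'n^'n) set"
  where "loewner_ointerval X Y = {Z. hermitian Z \<and> X \<prec> Z \<and> Z \<prec> Y}"

definition mat_eigenvalue :: "complex^'n^'n \<Rightarrow> complex \<Rightarrow> bool"
  where "mat_eigenvalue A c \<longleftrightarrow> (\<exists>v. v \<noteq> 0 \<and> A *v v = c *s v)"

text \<open>Only meant for matrices all of whose eigenvalues are real, such as Hermitian ones.\<close>
definition max_eigenvalue :: "complex^'n^'n \<Rightarrow> real"
  where "max_eigenvalue A = Max {r. mat_eigenvalue A (complex_of_real r)}"

text \<open>The type class norm on \<open>complex^'n^'n\<close> is the Frobenius norm, not this one.\<close>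
definition spectral_norm :: "complex^'n^'n \<Rightarrow> real"
  where "spectral_norm A = sqrt (max_eigenvalue (A\<^sup>\<dagger> ** A))"

end

theory Submission
  imports Defs
begin

text \<open>
  Put \<open>P X = V\<^sup>* X V + W\<^sup>* X W\<close> and \<open>R X = U\<^sup>* X U + B\<^sup>* X B\<close>. Since \<open>P X - R X = X + A\<^sup>* X B + B\<^sup>* X A\<close>,
  the equation says \<open>X = Q + P X - R X\<close>. Both \<open>P\<close> and \<open>R\<close> are monotone, and (c) gives
  \<open>(P + R) M \<le> \<delta> M\<close> with \<open>\<delta> < 1\<close>, so \<open>E \<mapsto> P E - R E\<close> contracts the gauge \<open>inf {t. - t M \<le> E \<le> t M}\<close>
  by \<open>\<delta>\<close>. Hence \<open>I - P + R\<close> is injective, and so bijective, on the Hermitian matrices. By (d) the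
  solution lies in \<open>[0, M]\<close>, thus above \<open>Q - R M > 0\<close> and below \<open>Q + P M\<close>. The same contraction gives
  errors of order \<open>\<delta>\<^sup>n\<close>, in any norm up to a constant.
\<close>

section \<open>The real inner product, conjugate transposes and Hermitian matrices\<close>

lemma inner_complex: "x \<bullet> y = Re (cnj x * y)" for x y :: complex
  by (simp add: inner_complex_def)

text \<open>The real inner product on \<open>complex^'n\<close> is the real part of the Hermitian
  one. In this shape forms can be treated with Cauchy-Schwarz, compactness and orthogonality in a
  real Euclidean space.\<close>

lemma quad_form_inner: "Re (quad_form A x) = x \<bullet> (A *v x)"
  by (simp add: quad_form_def inner_vec_def inner_complex)

lemma conj_transpose_inner: "x \<bullet> (A *v y) = (A\<^sup>\<dagger> *v x) \<bullet> y"
proof -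
  have "x \<bullet> (A *v y) = Re (\<Sum>i\<in>UNIV. \<Sum>j\<in>UNIV. cnj (x $ i) * (A $ i $ j * y $ j))"
    by (simp add: inner_vec_def inner_complex matrix_vector_mult_def sum_distrib_left
        del: times_complex.sel)
  also have "\<dots> = Re (\<Sum>j\<in>UNIV. \<Sum>i\<in>UNIV. cnj (x $ i) * (A $ i $ j * y $ j))"
    by (subst sum.swap) simp
  also have "\<dots> = (A\<^sup>\<dagger> *v x) \<bullet> y"
    by (simp add: inner_vec_def inner_complex matrix_vector_mult_def conj_transpose_def transpose_def
        map_matrix_def sum_distrib_left sum_distrib_right mult_ac del: times_complex.sel)
  finally show ?thesis .
qed

lemma conj_transpose_nth [simp]: "A\<^sup>\<dagger> $ i $ j = cnj (A $ j $ i)"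
  by (simp add: conj_transpose_def transpose_def map_matrix_def)

lemma conj_transpose_twice [simp]: "(A\<^sup>\<dagger>)\<^sup>\<dagger> = A" by (simp add: vec_eq_iff)

lemma conj_transpose_add: "(A + B)\<^sup>\<dagger> = A\<^sup>\<dagger> + B\<^sup>\<dagger>" by (simp add: vec_eq_iff)

lemma conj_transpose_diff: "(A - B)\<^sup>\<dagger> = A\<^sup>\<dagger> - B\<^sup>\<dagger>" by (simp add: vec_eq_iff)

lemma conj_transpose_scaleR: "(r *\<^sub>R A)\<^sup>\<dagger> = r *\<^sub>R A\<^sup>\<dagger>" by (simp add: vec_eq_iff)

lemma conj_transpose_mat: "(mat 1)\<^sup>\<dagger> = mat 1" by (simp add: vec_eq_iff mat_def)

lemma conj_transpose_mult: "(A ** B)\<^sup>\<dagger> = B\<^sup>\<dagger> ** A\<^sup>\<dagger>"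
  by (simp add: vec_eq_iff matrix_matrix_mult_def mult.commute)

lemma matrix_diff_mult: "(A - B) ** C = A ** C - B ** (C::complex^'n^'m)"
  by (simp add: vec_eq_iff matrix_matrix_mult_def left_diff_distrib sum_subtractf)

lemma matrix_mult_scaleR: "A ** (r *\<^sub>R C) = r *\<^sub>R (A ** (C::complex^'n^'m))"
  by (simp add: vec_eq_iff matrix_matrix_mult_def scaleR_right.sum)

lemma matrix_scaleR_mult: "(r *\<^sub>R A) ** C = r *\<^sub>R (A ** (C::complex^'n^'m))"
  by (simp add: vec_eq_iff matrix_matrix_mult_def scaleR_right.sum)

lemma matrix_add_mult: "(A + B) ** C = A ** C + B ** (C::complex^'n^'m)"
  by (simp add: vec_eq_iff matrix_matrix_mult_def distrib_right sum.distrib)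

lemma matrix_mult_diff: "C ** (A - B) = C ** A - C ** (B::complex^'n^'m)"
  by (simp add: vec_eq_iff matrix_matrix_mult_def right_diff_distrib sum_subtractf)

lemma scaleR_matrix_vector: "(r *\<^sub>R A) *v x = r *\<^sub>R (A *v (x::complex^'n))"
  by (simp add: vec_eq_iff matrix_vector_mult_def scaleR_right.sum)

lemma matrix_vector_scaleR: "A *v (r *\<^sub>R x) = r *\<^sub>R (A *v (x::complex^'n))"
  by (simp add: vec_eq_iff matrix_vector_mult_def scaleR_right.sum)

lemmas matrix_mult_linear = matrix_add_mult matrix_add_ldistrib matrix_diff_mult
  matrix_mult_diff matrix_scaleR_mult matrix_mult_scaleR

lemmas form_linear = matrix_vector_mult_add_rdistrib matrix_vector_mult_diff_rdistrib
  scaleR_matrix_vector inner_add_right inner_diff_right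

lemma hermitian_inner: "hermitian A \<Longrightarrow> x \<bullet> (A *v y) = (A *v x) \<bullet> y"
  by (simp add: hermitian_def conj_transpose_inner)

lemma hermitian_add: "hermitian A \<Longrightarrow> hermitian B \<Longrightarrow> hermitian (A + B)"
  by (simp add: hermitian_def conj_transpose_add)

lemma hermitian_diff: "hermitian A \<Longrightarrow> hermitian B \<Longrightarrow> hermitian (A - B)"
  by (simp add: hermitian_def conj_transpose_diff)

lemma hermitian_scaleR: "hermitian A \<Longrightarrow> hermitian (r *\<^sub>R A)"
  by (simp add: hermitian_def conj_transpose_scaleR)

lemma hermitian_0: "hermitian 0"
  by (simp add: hermitian_def vec_eq_iff)

lemma hermitian_mat_1: "hermitian (mat 1)"
  by (simp add: hermitian_def conj_transpose_mat)

lemma hermitian_congruence: "hermitian A \<Longrightarrow> hermitian (C\<^sup>\<dagger> ** A ** C)"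
  by (simp add: hermitian_def conj_transpose_mult matrix_mul_assoc)

lemma hermitian_gram: "hermitian (A\<^sup>\<dagger> ** A)"
  by (simp add: hermitian_def conj_transpose_mult)

lemma congruence_form: "x \<bullet> ((C\<^sup>\<dagger> ** A ** C) *v x) = (C *v x) \<bullet> (A *v (C *v x))"
  using conj_transpose_inner[of x "C\<^sup>\<dagger>" "A *v (C *v x)"]
  by (simp add: matrix_vector_mul_assoc matrix_mul_assoc)

lemma gram_form: "x \<bullet> ((A\<^sup>\<dagger> ** A) *v y) = (A *v x) \<bullet> (A *v y)"
  using conj_transpose_inner[of x "A\<^sup>\<dagger>" "A *v y"] by (simp add: matrix_vector_mul_assoc)

section \<open>Positive forms and their kernels\<close>

lemma pos_def_form: "pos_def A \<longleftrightarrow> hermitian A \<and> (\<forall>x. x \<noteq> 0 \<longrightarrow> 0 < x \<bullet> (A *v x))"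
  by (simp add: pos_def_def quad_form_inner)

lemma pos_semidef_form: "pos_semidef A \<longleftrightarrow> hermitian A \<and> (\<forall>x. 0 \<le> x \<bullet> (A *v x))"
  by (simp add: pos_semidef_def quad_form_inner)

lemma pos_def_form_nonneg: "pos_def A \<Longrightarrow> 0 \<le> x \<bullet> (A *v x)"
  by (cases "x = 0") (auto simp: pos_def_form less_imp_le)

text \<open>The form is minimal at \<open>x\<close>, so its first variation there vanishes: a small
  step from \<open>x\<close> along \<open>- A *v x\<close> would otherwise make it negative.\<close>

lemma pos_semidef_form_eq_0_imp_kernel:
  assumes A: "pos_semidef A" and x: "x \<bullet> (A *v x) = 0"
  shows "A *v x = 0"
proof (rule ccontr)
  assume "A *v x \<noteq> 0"
  define y where "y = A *v x"
  have h: "hermitian A" and nn: "\<And>z. 0 \<le> z \<bullet> (A *v z)"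
    using A by (auto simp: pos_semidef_form)
  define p where "p = y \<bullet> (A *v y)"
  define q where "q = y \<bullet> y"
  have q: "q > 0" using \<open>A *v x \<noteq> 0\<close> by (simp add: q_def y_def)
  have p: "p \<ge> 0" using nn by (simp add: p_def)
  have *: "0 \<le> s\<^sup>2 * p - 2 * s * q" for s
  proof -
    have "(x - s *\<^sub>R y) \<bullet> (A *v (x - s *\<^sub>R y)) = s\<^sup>2 * p - 2 * s * q"
      using x hermitian_inner[OF h, of x y]
      by (simp add: matrix_vector_mult_diff_distrib matrix_vector_scaleR inner_diff_left inner_diff_right
          p_def q_def y_def[symmetric] power2_eq_square algebra_simps)
    then show ?thesis using nn by metis
  qed
  \<comment> \<open>Any \<open>s > 0\<close> with \<open>s * p < 2 * q\<close> contradicts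
    \<open>*\<close>; the denominator \<open>p + 1\<close> also covers \<open>p = 0\<close>.\<close>
  define s where "s = q / (p + 1)"
  have s: "s > 0" "q = s * (p + 1)" using p q by (simp_all add: s_def)
  have "s\<^sup>2 * p - 2 * s * q = - (s\<^sup>2 * (p + 2))"
    by (simp add: s(2) power2_eq_square algebra_simps)
  moreover have "0 < s\<^sup>2 * (p + 2)" using s p by simp
  ultimately show False using *[of s] by linarith
qed

lemma hermitian_form_eq_0_imp_0:
  assumes "hermitian A" and "\<And>x. x \<bullet> (A *v x) = 0"
  shows "A = 0"
proof -
  have "pos_semidef A" using assms by (simp add: pos_semidef_form)
  then have "A *v x = 0" for x
    using assms pos_semidef_form_eq_0_imp_kernel by blast
  then show ?thesis by (simp add: matrix_eq)
qed

section \<open>Extreme values of a form on the unit sphere\<close>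

lemma continuous_on_form: "continuous_on S (\<lambda>x. x \<bullet> (A *v x))" for A :: "complex^'n^'n"
  by (intro continuous_intros linear_continuous_on matrix_vector_mul_bounded_linear)

lemma form_unit_scale:
  fixes A :: "complex^'n^'n"
  shows "x \<bullet> (A *v x) = (norm x)\<^sup>2 * (sgn x \<bullet> (A *v sgn x))"
proof (cases "x = 0")
  case False
  have "sgn x \<bullet> (A *v sgn x) = x \<bullet> (A *v x) / (norm x)\<^sup>2"
    by (simp add: sgn_div_norm matrix_vector_scaleR power2_eq_square divide_inverse)
  with False show ?thesis by simp
qed simp

lemma form_attains_sup:
  fixes A :: "complex^'n^'n"
  obtains u where "norm u = 1" and "\<And>x. x \<bullet> (A *v x) \<le> (u \<bullet> (A *v u)) * (norm x)\<^sup>2"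
proof -
  obtain e :: "complex^'n" where "norm e = 1"
    using vector_choose_size[of 1] by auto
  then have "sphere 0 1 \<noteq> ({} :: (complex^'n) set)" by auto
  then obtain u :: "complex^'n" where u: "norm u = 1"
    and m: "\<And>y. norm y = 1 \<Longrightarrow> y \<bullet> (A *v y) \<le> u \<bullet> (A *v u)"
    using continuous_attains_sup[OF compact_sphere _ continuous_on_form[of _ A], of 0 1] by auto
  have "x \<bullet> (A *v x) \<le> (u \<bullet> (A *v u)) * (norm x)\<^sup>2" for x
  proof (cases "x = 0")
    case False
    then have "(norm x)\<^sup>2 * (sgn x \<bullet> (A *v sgn x)) \<le> (norm x)\<^sup>2 * (u \<bullet> (A *v u))"
      by (intro mult_left_mono m) (auto simp: norm_sgn)
    then show ?thesis by (subst form_unit_scale) (simp add: mult.commute)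
  qed simp
  with u show ?thesis using that by blast
qed

lemma pos_def_lower_bound:
  assumes "pos_def A"
  obtains m where "0 < m" and "\<And>x. m * (norm x)\<^sup>2 \<le> x \<bullet> (A *v x)"
proof -
  \<comment> \<open>The minimum of the form of \<open>A\<close> is found as the maximum for
    \<open>- A\<close>; being attained, it is positive.\<close>
  obtain u where u: "norm u = 1"
    and m: "\<And>x. x \<bullet> (((-1) *\<^sub>R A) *v x) \<le> (u \<bullet> (((-1) *\<^sub>R A) *v u)) * (norm x)\<^sup>2"
    using form_attains_sup by blast
  have "0 < u \<bullet> (A *v u)" using assms u by (auto simp: pos_def_form dest: spec[of _ u])
  moreover have "(u \<bullet> (A *v u)) * (norm x)\<^sup>2 \<le> x \<bullet> (A *v x)" for x
    using m[of x] by (simp add: scaleR_matrix_vector del: scaleR_minus1_left scaleR_minus_left)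
  ultimately show ?thesis using that by blast
qed

section \<open>The gauge of a positive definite matrix\<close>

text \<open>This is - t M \<le> E \<le> t M read on forms, so that estimates carry no Hermitian side
  conditions.\<close>

definition form_bounded :: "real \<Rightarrow> complex^'n^'n \<Rightarrow> complex^'n^'n \<Rightarrow> bool"
  where "form_bounded t M E \<longleftrightarrow> (\<forall>x. \<bar>x \<bullet> (E *v x)\<bar> \<le> t * (x \<bullet> (M *v x)))"

lemma form_bounded_by_pos_def:
  assumes "pos_def M"
  obtains t where "0 \<le> t" and "form_bounded t M E"
proof -
  obtain m where m: "0 < m" "\<And>x. m * (norm x)\<^sup>2 \<le> x \<bullet> (M *v x)"
    using pos_def_lower_bound[OF assms] by blast
  obtain K where K: "0 < K" "\<And>x. norm (E *v x) \<le> norm x * K"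
    using bounded_linear.pos_bounded[OF matrix_vector_mul_bounded_linear[of E]] by blast
  have "\<bar>x \<bullet> (E *v x)\<bar> \<le> K / m * (x \<bullet> (M *v x))" for x
  proof -
    have "\<bar>x \<bullet> (E *v x)\<bar> \<le> norm x * norm (E *v x)" by (rule Cauchy_Schwarz_ineq2)
    also have "\<dots> \<le> norm x * (norm x * K)" by (intro mult_left_mono K) auto
    also have "\<dots> = K / m * (m * (norm x)\<^sup>2)" using m by (simp add: power2_eq_square)
    also have "\<dots> \<le> K / m * (x \<bullet> (M *v x))" using m K by (intro mult_left_mono) auto
    finally show ?thesis .
  qed
  then show ?thesis using that[of "K / m"] m K by (auto simp: form_bounded_def)
qed

text \<open>Strictness becomes a uniform factor because \<open>M - S\<close>, being positive
  definite, dominates a positive multiple of \<open>M\<close>.\<close>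

lemma pos_def_contraction_factor:
  assumes M: "pos_def M" and S: "pos_def (M - S)"
  obtains \<delta> where "0 < \<delta>" "\<delta> < 1" "\<And>x. x \<bullet> (S *v x) \<le> \<delta> * (x \<bullet> (M *v x))"
proof -
  obtain t where t: "0 \<le> t" "form_bounded t (M - S) M"
    using form_bounded_by_pos_def[OF S] by blast
  \<comment> \<open>Adding \<open>2\<close> to \<open>t\<close> keeps \<delta> positive even for
    \<open>t = 0\<close>.\<close>
  define \<delta> where "\<delta> = 1 - 1 / (t + 2)"
  have "x \<bullet> (S *v x) \<le> \<delta> * (x \<bullet> (M *v x))" for x
  proof -
    have "x \<bullet> (M *v x) \<le> t * (x \<bullet> ((M - S) *v x))" using t by (auto simp: form_bounded_def abs_le_iff)
    also have "\<dots> \<le> (t + 2) * (x \<bullet> ((M - S) *v x))"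
      using pos_def_form_nonneg[OF S] by (intro mult_right_mono) auto
    finally have "x \<bullet> (M *v x) / (t + 2) \<le> x \<bullet> (M *v x) - x \<bullet> (S *v x)"
      using t by (simp add: field_simps form_linear)
    then show ?thesis by (simp add: \<delta>_def algebra_simps)
  qed
  moreover have "0 < \<delta>" "\<delta> < 1" using t by (auto simp: \<delta>_def field_simps)
  ultimately show ?thesis using that by blast
qed

section \<open>Real eigenvalues of Hermitian matrices and the spectral norm\<close>

lemma of_real_vector_scalar_mult: "complex_of_real r *s v = r *\<^sub>R v"
  by (simp add: vec_eq_iff scaleR_conv_of_real[where 'a=complex])

text \<open>Eigenvectors for distinct eigenvalues are orthogonal, hence independent, hence finitely
  many. Finiteness is what gives the \<open>Max\<close> in \<open>max_eigenvalue\<close> its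
  meaning.\<close>

lemma hermitian_real_eigenvalues_finite:
  assumes "hermitian (A :: complex^'n^'n)"
  shows "finite {r. mat_eigenvalue A (complex_of_real r)}" (is "finite ?R")
proof -
  have "\<forall>r\<in>?R. \<exists>v. v \<noteq> 0 \<and> A *v v = r *\<^sub>R v"
    by (simp add: mat_eigenvalue_def of_real_vector_scalar_mult)
  from bchoice[OF this] obtain v where "\<forall>r\<in>?R. v r \<noteq> 0 \<and> A *v v r = r *\<^sub>R v r" ..
  then have v: "\<And>r. r \<in> ?R \<Longrightarrow> v r \<noteq> 0 \<and> A *v v r = r *\<^sub>R v r" by blast
  have orth: "v r \<bullet> v s = 0" if "r \<in> ?R" "s \<in> ?R" "r \<noteq> s" for r s
  proof -
    have "s * (v r \<bullet> v s) = r * (v r \<bullet> v s)"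
      using hermitian_inner[OF assms, of "v r" "v s"] v that by simp
    with that show ?thesis by simp
  qed
  have "pairwise orthogonal (v ` ?R)"
    unfolding pairwise_def orthogonal_def using orth by auto
  moreover have "0 \<notin> v ` ?R" using v by force
  ultimately have "finite (v ` ?R)"
    using independent_imp_finite pairwise_orthogonal_independent by blast
  moreover have "inj_on v ?R"
    by (rule inj_onI) (metis orth v inner_eq_zero_iff)
  ultimately show ?thesis using finite_imageD by blast
qed

text \<open>If \<open>r\<close> is the maximum of the form on the unit sphere, then
  \<open>r *\<^sub>R mat 1 - A\<close> is semidefinite and its form vanishes at the maximizer, which
  therefore lies in its kernel.\<close>

lemma hermitian_has_real_eigenvalue:
  assumes "hermitian (A :: complex^'n^'n)"
  shows "\<exists>r. mat_eigenvalue A (complex_of_real r)"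
proof -
  obtain u where u: "norm u = 1"
    and m: "\<And>x. x \<bullet> (A *v x) \<le> (u \<bullet> (A *v u)) * (norm x)\<^sup>2"
    using form_attains_sup by blast
  define r where "r = u \<bullet> (A *v u)"
  define K where "K = r *\<^sub>R mat 1 - A"
  have form: "x \<bullet> (K *v x) = r * (norm x)\<^sup>2 - x \<bullet> (A *v x)" for x
    by (simp add: K_def form_linear power2_norm_eq_inner)
  have "pos_semidef K"
    using m assms by (simp add: pos_semidef_form form K_def[symmetric] r_def)
      (simp add: K_def hermitian_diff hermitian_scaleR hermitian_mat_1)
  moreover have "u \<bullet> (K *v u) = 0" by (simp add: form u r_def)
  ultimately have "K *v u = 0" by (rule pos_semidef_form_eq_0_imp_kernel)
  then have "A *v u = r *\<^sub>R u" by (simp add: K_def form_linear)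
  moreover have "u \<noteq> 0" using u by auto
  ultimately show ?thesis unfolding mat_eigenvalue_def of_real_vector_scalar_mult by blast
qed

lemma spectral_norm_singular_vector:
  fixes A :: "complex^'n^'n"
  obtains v where "v \<noteq> 0" "(A\<^sup>\<dagger> ** A) *v v = (spectral_norm A)\<^sup>2 *\<^sub>R v"
    "norm (A *v v) = spectral_norm A * norm v" "0 \<le> spectral_norm A"
proof -
  let ?R = "{r. mat_eigenvalue (A\<^sup>\<dagger> ** A) (complex_of_real r)}"
  have "Max ?R \<in> ?R"
    using hermitian_real_eigenvalues_finite[OF hermitian_gram, of A]
      hermitian_has_real_eigenvalue[OF hermitian_gram, of A] by (intro Max_in) auto
  then obtain v where v: "v \<noteq> 0" "(A\<^sup>\<dagger> ** A) *v v = max_eigenvalue (A\<^sup>\<dagger> ** A) *\<^sub>R v"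
    unfolding max_eigenvalue_def mat_eigenvalue_def of_real_vector_scalar_mult by blast
  have *: "(norm (A *v v))\<^sup>2 = max_eigenvalue (A\<^sup>\<dagger> ** A) * (norm v)\<^sup>2"
    using gram_form[of v A v] v by (simp add: power2_norm_eq_inner)
  \<comment> \<open>The sign is settled first, since squaring \<open>sqrt\<close> returns its
    argument only if that is nonnegative.\<close>
  have nn: "0 \<le> max_eigenvalue (A\<^sup>\<dagger> ** A)"
    using * v(1) by (metis zero_le_mult_iff zero_le_power2 zero_less_norm_iff zero_less_power not_le)
  then have sq: "max_eigenvalue (A\<^sup>\<dagger> ** A) = (spectral_norm A)\<^sup>2"
    by (simp add: spectral_norm_def)
  have sn: "0 \<le> spectral_norm A" using nn by (simp add: spectral_norm_def)
  have "norm (A *v v) = spectral_norm A * norm v"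
    by (rule power2_eq_imp_eq) (use * sn in \<open>auto simp: sq power_mult_distrib\<close>)
  with v sn sq that show ?thesis by metis
qed

lemma spectral_norm_nonneg: "0 \<le> spectral_norm A"
  by (rule spectral_norm_singular_vector)

lemma pos_def_spectral_norm_pos:
  assumes "pos_def A"
  shows "0 < spectral_norm A"
proof -
  obtain v where v: "v \<noteq> 0" "norm (A *v v) = spectral_norm A * norm v" "0 \<le> spectral_norm A"
    by (rule spectral_norm_singular_vector[of A])
  have "A *v v \<noteq> 0" using assms v(1) by (auto simp: pos_def_form)
  with v show ?thesis by (metis less_eq_real_def mult_zero_left norm_eq_zero)
qed

text \<open>If \<open>A\<^sup>2 v = s\<^sup>2 v\<close> then \<open>A v + s v\<close> is an eigenvector of \<open>A\<close> for \<open>s\<close>, or it vanishes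
  and \<open>v\<close> is an eigenvector for \<open>- s\<close>.\<close>
lemma hermitian_spectral_norm_le:
  assumes A: "hermitian A" and bound: "\<And>x. \<bar>x \<bullet> (A *v x)\<bar> \<le> t * (norm x)\<^sup>2"
  shows "spectral_norm A \<le> t"
proof -
  define s where "s = spectral_norm A"
  obtain v where v: "v \<noteq> 0" "(A\<^sup>\<dagger> ** A) *v v = s\<^sup>2 *\<^sub>R v" and s: "0 \<le> s"
    unfolding s_def by (rule spectral_norm_singular_vector[of A])
  have sq: "A *v (A *v v) = s\<^sup>2 *\<^sub>R v"
    using v(2) A by (simp add: hermitian_def matrix_vector_mul_assoc)
  define w where "w = A *v v + s *\<^sub>R v"
  have eig: "s \<le> t" if "A *v x = r *\<^sub>R x" "\<bar>r\<bar> = s" "x \<noteq> 0" for x r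
  proof -
    have "s * (norm x)\<^sup>2 \<le> t * (norm x)\<^sup>2"
      using bound[of x] that by (simp add: abs_mult power2_norm_eq_inner)
    with that show ?thesis by simp
  qed
  show ?thesis
  proof (cases "w = 0")
    case True
    then have "A *v v = (- s) *\<^sub>R v" by (simp add: w_def eq_neg_iff_add_eq_0)
    then show ?thesis using eig[of v "- s"] v s s_def by simp
  next
    case False
    have "A *v w = s *\<^sub>R w"
      by (simp add: w_def matrix_vector_right_distrib matrix_vector_scaleR sq
          scaleR_add_right power2_eq_square add.commute)
    then show ?thesis using eig[of w s] False s s_def by simp
  qed
qed

text \<open>Transfers gauge estimates to the spectral norm. The constant depends on \<open>M\<close>
  alone, so it is the same along a whole iteration.\<close>

lemma form_bounded_spectral_norm:
  fixes M :: "complex^'n^'n"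
  obtains K where "0 < K"
    "\<And>E t. hermitian E \<Longrightarrow> 0 \<le> t \<Longrightarrow> form_bounded t M E \<Longrightarrow> spectral_norm E \<le> t * K"
proof -
  obtain u where K: "\<And>x. x \<bullet> (M *v x) \<le> (u \<bullet> (M *v u)) * (norm x)\<^sup>2"
    using form_attains_sup by blast
  define K where "K = max 1 (u \<bullet> (M *v u))"
  have "spectral_norm E \<le> t * K" if "hermitian E" "0 \<le> t" "form_bounded t M E" for E t
  proof (rule hermitian_spectral_norm_le[OF that(1)])
    fix x
    have "\<bar>x \<bullet> (E *v x)\<bar> \<le> t * (x \<bullet> (M *v x))" using that(3) by (simp add: form_bounded_def)
    also have "\<dots> \<le> t * (K * (norm x)\<^sup>2)"
      by (rule mult_left_mono[OF order_trans[OF K mult_right_mono] that(2)]) (auto simp: K_def)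
    finally show "\<bar>x \<bullet> (E *v x)\<bar> \<le> t * K * (norm x)\<^sup>2" by (simp add: mult.assoc)
  qed
  then show ?thesis using that[of K] by (simp add: K_def)
qed

section \<open>Sums of two congruences\<close>

text \<open>One definition for both maps: \<open>P\<close> is \<open>cong_sum V W\<close> and
  \<open>R\<close> is \<open>cong_sum U B\<close>.\<close>

definition cong_sum :: "complex^'n^'n \<Rightarrow> complex^'n^'n \<Rightarrow> complex^'n^'n \<Rightarrow> complex^'n^'n"
  where "cong_sum C D X = C\<^sup>\<dagger> ** X ** C + D\<^sup>\<dagger> ** X ** D"

lemma cong_sum_add: "cong_sum C D (X + Y) = cong_sum C D X + cong_sum C D Y"
  and cong_sum_diff: "cong_sum C D (X - Y) = cong_sum C D X - cong_sum C D Y"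
  and cong_sum_scaleR: "cong_sum C D (r *\<^sub>R X) = r *\<^sub>R cong_sum C D X"
  by (simp_all add: cong_sum_def matrix_mult_linear algebra_simps)

lemma hermitian_cong_sum: "hermitian X \<Longrightarrow> hermitian (cong_sum C D X)"
  by (simp add: cong_sum_def hermitian_add hermitian_congruence)

lemma cong_sum_form:
  "x \<bullet> (cong_sum C D X *v x) = (C *v x) \<bullet> (X *v (C *v x)) + (D *v x) \<bullet> (X *v (D *v x))"
  by (simp add: cong_sum_def form_linear congruence_form)

text \<open>Monotonicity in gauge form: the bound on \<open>E\<close> is used at the vectors
  \<open>C *v x\<close> and \<open>D *v x\<close>.\<close>

lemma form_bounded_cong_sum:
  assumes "form_bounded t M E"
  shows "\<bar>x \<bullet> (cong_sum C D E *v x)\<bar> \<le> t * (x \<bullet> (cong_sum C D M *v x))"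
proof -
  have "\<bar>y \<bullet> (E *v y)\<bar> \<le> t * (y \<bullet> (M *v y))" for y
    using assms by (simp add: form_bounded_def)
  from this[of "C *v x"] this[of "D *v x"] show ?thesis
    by (simp add: cong_sum_form distrib_left)
qed

section \<open>Contraction, solvability and convergence\<close>

locale dominated_cong_sums =
  fixes U B V W M :: "complex^'n^'n" and \<delta> :: real
  assumes M: "pos_def M"
    and \<delta>: "0 < \<delta>" "\<delta> < 1"
    and dominated: "x \<bullet> ((cong_sum V W M + cong_sum U B M) *v x) \<le> \<delta> * (x \<bullet> (M *v x))"
begin

abbreviation "P \<equiv> cong_sum V W"
abbreviation "R \<equiv> cong_sum U B"

text \<open>The minus sign before \<open>R\<close> is harmless, as the absolute values add up to
  \<open>t\<close> times the form of \<open>P M + R M\<close>. Two arguments are allowed because the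
  coupled iteration feeds different errors to \<open>P\<close> and \<open>R\<close>.\<close>

lemma contraction:
  assumes "0 \<le> t" "form_bounded t M E" "form_bounded t M D"
  shows "form_bounded (\<delta> * t) M (P E - R D)"
  unfolding form_bounded_def
proof
  fix x
  have "\<bar>x \<bullet> ((P E - R D) *v x)\<bar> \<le> t * (x \<bullet> ((P M + R M) *v x))"
    using form_bounded_cong_sum[OF assms(2), of x V W] form_bounded_cong_sum[OF assms(3), of x U B]
    by (simp add: form_linear distrib_left)
  also have "\<dots> \<le> t * (\<delta> * (x \<bullet> (M *v x)))"
    by (intro mult_left_mono dominated assms)
  finally show "\<bar>x \<bullet> ((P E - R D) *v x)\<bar> \<le> \<delta> * t * (x \<bullet> (M *v x))" by (simp add: mult_ac)
qed

lemma iterate_form_bounded: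
  assumes c: "0 \<le> c" "form_bounded c M (E 0)" "form_bounded c M (D 0)"
    and E: "\<And>n. E (Suc n) = P (E n) - R (D n)" and D: "\<And>n. D (Suc n) = P (D n) - R (E n)"
  shows "form_bounded (\<delta> ^ n * c) M (E n) \<and> form_bounded (\<delta> ^ n * c) M (D n)"
proof (induction n)
  case (Suc n)
  then show ?case using contraction[of "\<delta> ^ n * c"] c \<delta> by (simp add: E D mult.assoc)
qed (use c in simp)

lemma power_tendsto_0: "(\<lambda>n. \<delta> ^ n * c) \<longlonglongrightarrow> 0"
  using LIMSEQ_power_zero[of \<delta>] \<delta> by (intro tendsto_mult_left_zero) auto

lemma hermitian_fixed_point_0:
  assumes h: "hermitian E" and eq: "E = P E - R E"
  shows "E = 0"
proof (rule hermitian_form_eq_0_imp_0[OF h])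
  fix x
  obtain c where c: "0 \<le> c" "form_bounded c M E" using form_bounded_by_pos_def[OF M] by blast
  \<comment> \<open>By \<open>eq\<close>, the constant sequence \<open>E\<close> satisfies both
    recursions.\<close>
  have "\<bar>x \<bullet> (E *v x)\<bar> \<le> \<delta> ^ n * (c * (x \<bullet> (M *v x)))" for n
    using iterate_form_bounded[of c "\<lambda>_. E" "\<lambda>_. E" n] c eq
    by (simp add: form_bounded_def mult.assoc)
  then have "\<bar>x \<bullet> (E *v x)\<bar> \<le> 0" using power_tendsto_0 LIMSEQ_le_const by blast
  then show "x \<bullet> (E *v x) = 0" by simp
qed

lemma hermitian_solution_unique:
  assumes "hermitian X" "hermitian Y" "X = Q + P X - R X" "Y = Q + P Y - R Y"
  shows "X = Y"
proof -
  have "X - Y = (Q + P X - R X) - (Q + P Y - R Y)"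
    by (rule arg_cong2[where f = minus, OF assms(3,4)])
  also have "\<dots> = P (X - Y) - R (X - Y)"
    by (simp add: cong_sum_diff)
  finally have "X - Y = P (X - Y) - R (X - Y)" .
  with hermitian_fixed_point_0 hermitian_diff assms(1,2) have "X - Y = 0" by blast
  then show ?thesis by simp
qed

text \<open>The Hermitian matrices form a finite-dimensional real subspace that \<Phi> maps into
  itself, so injectivity of \<Phi> on it yields surjectivity by counting dimensions.\<close>

lemma hermitian_solution_exists:
  assumes "hermitian Q"
  obtains X where "hermitian X" "X = Q + P X - R X"
proof -
  define \<Phi> where "\<Phi> X = X - (P X - R X)" for X
  define H where "H = {X :: complex^'n^'n. hermitian X}"
  have lin: "linear \<Phi>"
    by (rule linearI) (simp_all add: \<Phi>_def cong_sum_add cong_sum_scaleR algebra_simps)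
  have sub: "subspace H"
    by (auto simp: H_def subspace_def hermitian_0 hermitian_add hermitian_scaleR)
  have "inj_on \<Phi> H"
    using hermitian_fixed_point_0
    by (subst linear_inj_on_iff_eq_0[OF lin sub]) (auto simp: \<Phi>_def H_def)
  then have "dim (\<Phi> ` H) = dim H"
    using lin sub by (intro dim_image_eq) (simp_all add: span_eq_iff[THEN iffD2])
  moreover have "\<Phi> ` H \<subseteq> H"
    by (auto simp: \<Phi>_def H_def hermitian_diff hermitian_cong_sum)
  ultimately have "\<Phi> ` H = H"
    using subspace_dim_equal[OF linear_subspace_image[OF lin sub] sub] by simp
  then have "Q \<in> \<Phi> ` H" using assms by (simp add: H_def)
  then obtain X where "X \<in> H" "\<Phi> X = Q" by blast
  then show ?thesis using that[of X] by (auto simp: \<Phi>_def H_def algebra_simps)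
qed

text \<open>The deviation \<open>E\<close> of a solution from the midpoint \<open>M/2\<close> of the order interval \<open>[0,M]\<close>
  satisfies \<open>\<bar>E\<bar> \<le> (1/2 + c) M \<Longrightarrow> \<bar>E\<bar> \<le> (1/2 + \<delta> c) M\<close>.\<close>
lemma solution_between:
  assumes sol: "X = Q + P X - R X"
    and Q: "\<And>x. x \<bullet> (R M *v x) \<le> x \<bullet> (Q *v x)" "\<And>x. x \<bullet> (Q *v x) \<le> x \<bullet> ((M - P M) *v x)"
  shows "0 \<le> x \<bullet> (X *v x)" "x \<bullet> (X *v x) \<le> x \<bullet> (M *v x)"
proof -
  define E where "E = X - (1/2) *\<^sub>R M"
  have E: "E = (P E - R E) + (Q + (1/2) *\<^sub>R (P M - R M - M))"
    using sol by (simp add: E_def cong_sum_diff cong_sum_scaleR algebra_simps)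
  have step: "form_bounded (1/2 + \<delta> * c) M E" if c: "0 \<le> c" "form_bounded (1/2 + c) M E" for c
    unfolding form_bounded_def
  proof
    fix x
    have 1: "\<bar>x \<bullet> ((P E - R E) *v x)\<bar> \<le> (1/2 + c) * (x \<bullet> ((P M + R M) *v x))"
      using form_bounded_cong_sum[OF c(2), of x V W] form_bounded_cong_sum[OF c(2), of x U B]
      by (simp add: form_linear distrib_left)
    \<comment> \<open>The assumptions place \<open>Q\<close> between \<open>R M\<close> and
      \<open>M - P M\<close>. The left side measures the distance of \<open>Q\<close> from their
      midpoint, the right side is half the width. Added to \<open>1\<close>, the halves of
      \<open>P M + R M\<close> cancel.\<close>
    have 2: "\<bar>x \<bullet> ((Q + (1/2) *\<^sub>R (P M - R M - M)) *v x)\<bar>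
        \<le> 1/2 * (x \<bullet> (M *v x)) - 1/2 * (x \<bullet> ((P M + R M) *v x))"
      using Q[of x] by (simp add: form_linear abs_le_iff field_simps)
    have "\<bar>x \<bullet> (E *v x)\<bar> \<le> 1/2 * (x \<bullet> (M *v x)) + c * (x \<bullet> ((P M + R M) *v x))"
      using 1 2 by (subst E, subst matrix_vector_mult_add_rdistrib, subst inner_add_right)
        (simp add: distrib_right)
    also have "\<dots> \<le> 1/2 * (x \<bullet> (M *v x)) + c * (\<delta> * (x \<bullet> (M *v x)))"
      by (intro add_left_mono mult_left_mono dominated c)
    finally show "\<bar>x \<bullet> (E *v x)\<bar> \<le> (1/2 + \<delta> * c) * (x \<bullet> (M *v x))" by (simp add: algebra_simps)
  qed
  obtain c where c: "0 \<le> c" "form_bounded c M E" using form_bounded_by_pos_def[OF M] by blast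
  have "form_bounded (1/2 + \<delta> ^ n * c) M E" for n
  proof (induction n)
    case 0
    then show ?case using c pos_def_form_nonneg[OF M]
      by (simp add: form_bounded_def distrib_right add_increasing)
  next
    case (Suc n)
    then show ?case using step[of "\<delta> ^ n * c"] c \<delta> by (simp add: mult.assoc)
  qed
  then have "\<bar>x \<bullet> (E *v x)\<bar> - 1/2 * (x \<bullet> (M *v x)) \<le> \<delta> ^ n * (c * (x \<bullet> (M *v x)))" for n
    by (simp add: form_bounded_def algebra_simps)
  then have "\<bar>x \<bullet> (E *v x)\<bar> - 1/2 * (x \<bullet> (M *v x)) \<le> 0"
    using power_tendsto_0 LIMSEQ_le_const by blast
  then show "0 \<le> x \<bullet> (X *v x)" "x \<bullet> (X *v x) \<le> x \<bullet> (M *v x)"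
    unfolding E_def form_linear by (simp_all add: abs_le_iff field_simps)
qed

text \<open>Subtracting the fixed point equation removes \<open>Q\<close>, so the errors follow the
  homogeneous coupled recursion of \<open>iterate_form_bounded\<close>. They are shown to stay
  Hermitian because the passage to the spectral norm requires it.\<close>

lemma coupled_iteration_spectral_norm:
  assumes h: "hermitian Q" "hermitian Xhat" "hermitian (X 0)" "hermitian (Y 0)"
    and sol: "Xhat = Q + P Xhat - R Xhat"
    and X: "\<And>n. X (Suc n) = Q + P (X n) - R (Y n)"
    and Y: "\<And>n. Y (Suc n) = Q + P (Y n) - R (X n)"
  obtains C where "0 < C"
    "\<And>n. spectral_norm (X n - Xhat) \<le> C * \<delta> ^ n" "\<And>n. spectral_norm (Y n - Xhat) \<le> C * \<delta> ^ n"
proof -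
  define E where "E n = X n - Xhat" for n
  define D where "D n = Y n - Xhat" for n
  have E: "E (Suc n) = P (E n) - R (D n)" for n
    using arg_cong2[where f = minus, OF X[of n] sol] by (simp add: E_def D_def cong_sum_diff)
  have D: "D (Suc n) = P (D n) - R (E n)" for n
    using arg_cong2[where f = minus, OF Y[of n] sol] by (simp add: E_def D_def cong_sum_diff)
  have herm: "hermitian (E n) \<and> hermitian (D n)" for n
    by (induction n) (simp_all add: E D hermitian_diff hermitian_cong_sum, simp add: E_def D_def hermitian_diff h)
  obtain c1 where c1: "0 \<le> c1" "form_bounded c1 M (E 0)" using form_bounded_by_pos_def[OF M] by blast
  obtain c2 where c2: "0 \<le> c2" "form_bounded c2 M (D 0)" using form_bounded_by_pos_def[OF M] by blast
  \<comment> \<open>One bound for both initial errors; the added \<open>1\<close> makes it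
    positive.\<close>
  define c where "c = c1 + c2 + 1"
  have c: "0 < c" "form_bounded c M (E 0)" "form_bounded c M (D 0)"
    using c1 c2 pos_def_form_nonneg[OF M]
    by (auto simp: c_def form_bounded_def distrib_right add_increasing add_increasing2)
  obtain K where K: "0 < K"
    "\<And>E t. hermitian E \<Longrightarrow> 0 \<le> t \<Longrightarrow> form_bounded t M E \<Longrightarrow> spectral_norm E \<le> t * K"
    using form_bounded_spectral_norm[of M] by blast
  have *: "spectral_norm (E n) \<le> \<delta> ^ n * c * K \<and> spectral_norm (D n) \<le> \<delta> ^ n * c * K" for n
    using K(2)[of _ "\<delta> ^ n * c"] herm[of n] c \<delta> iterate_form_bounded[of c E D n, OF _ c(2,3) E D] by simp
  show ?thesis
    by (rule that[of "c * K"]) (use * c(1) K(1) in \<open>auto simp: E_def D_def mult_ac\<close>)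
qed

end

section \<open>Absorbing constants, the fixed point identity and the theorem\<close>

text \<open>The factor \<open>1 / (1 - \<delta>)\<close> is unbounded as \<open>\<delta>\<close> approaches \<open>1\<close>, so it absorbs any constant.\<close>
lemma geometric_bound_absorb_constant:
  fixes C m \<delta> :: real
  assumes "0 < \<delta>" "\<delta> < 1" "0 < m"
  obtains \<epsilon> where "0 < \<epsilon>" "\<epsilon> < 1" "\<And>n. C * \<delta> ^ n \<le> \<epsilon> ^ n / (1 - \<epsilon>) * m"
proof -
  define K where "K = max 1 C"
  \<comment> \<open>The first entry gives \<delta> \<le> \<epsilon>, the second makes
    \<open>m / (1 - \<epsilon>)\<close> at least \<open>K\<close>.\<close>
  define \<epsilon> where "\<epsilon> = max \<delta> (1 - m / K)"
  have K: "K > 0" "C \<le> K" by (auto simp: K_def)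
  have eps: "0 < \<epsilon>" "\<epsilon> < 1" "\<delta> \<le> \<epsilon>" using assms K by (auto simp: \<epsilon>_def)
  have "1 - \<epsilon> \<le> m / K" by (auto simp: \<epsilon>_def)
  then have "K \<le> m / (1 - \<epsilon>)" using K eps by (simp add: field_simps)
  then have "C \<le> m / (1 - \<epsilon>)" using K by simp
  have "C * \<delta> ^ n \<le> \<epsilon> ^ n / (1 - \<epsilon>) * m" for n
  proof -
    have "C * \<delta> ^ n \<le> m / (1 - \<epsilon>) * \<delta> ^ n"
      using \<open>C \<le> m / (1 - \<epsilon>)\<close> assms by (intro mult_right_mono) auto
    also have "\<dots> \<le> m / (1 - \<epsilon>) * \<epsilon> ^ n"
      using eps assms by (intro mult_left_mono power_mono) auto
    finally show ?thesis by (simp add: mult_ac)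
  qed
  with eps that show ?thesis by blast
qed

text \<open>With \<open>C = A + mat 1\<close>, polarization turns the \<open>V\<close> and
  \<open>U\<close> terms into the mixed terms of \<open>C\<close> and \<open>B\<close>. The
  \<open>W\<close> and \<open>B\<close> terms leave
  \<open>X - X ** B - B\<^sup>\<dagger> ** X\<close>, which cancels what the identity in
  \<open>C\<close> contributes.\<close>

lemma fixed_point_form:
  fixes A B X :: "complex^'n^'n"
  assumes U: "U = (1 / sqrt 2) *\<^sub>R (A - B + mat 1)"
    and V: "V = (1 / sqrt 2) *\<^sub>R (A + B + mat 1)"
    and W: "W = B - mat 1"
  shows "cong_sum V W X - cong_sum U B X = X + (A\<^sup>\<dagger> ** X ** B + B\<^sup>\<dagger> ** X ** A)"
proof -
  define C where "C = A + mat 1"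
  have sq: "((1 / sqrt 2) *\<^sub>R D)\<^sup>\<dagger> ** X ** ((1 / sqrt 2) *\<^sub>R D) = (1/2) *\<^sub>R (D\<^sup>\<dagger> ** X ** D)"
    for D :: "complex^'n^'n"
    by (simp add: conj_transpose_scaleR matrix_mult_scaleR matrix_scaleR_mult)
  have UV: "U = (1 / sqrt 2) *\<^sub>R (C - B)" "V = (1 / sqrt 2) *\<^sub>R (C + B)"
    by (simp_all add: U V C_def algebra_simps)
  have "(C + B)\<^sup>\<dagger> ** X ** (C + B) - (C - B)\<^sup>\<dagger> ** X ** (C - B)
      = 2 *\<^sub>R (C\<^sup>\<dagger> ** X ** B + B\<^sup>\<dagger> ** X ** C)"
    by (simp add: conj_transpose_add conj_transpose_diff matrix_mult_linear scaleR_2)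
  then have "V\<^sup>\<dagger> ** X ** V - U\<^sup>\<dagger> ** X ** U = C\<^sup>\<dagger> ** X ** B + B\<^sup>\<dagger> ** X ** C"
    unfolding UV sq scaleR_diff_right[symmetric] by simp
  then show ?thesis
    unfolding cong_sum_def W C_def
    by (simp add: conj_transpose_add conj_transpose_diff conj_transpose_mat matrix_mult_linear algebra_simps)
qed

theorem theorem3p1:
  fixes Q A B U V W Qt M :: "complex^'n^'n"
  assumes Q: "pos_def Q"
    and U: "U = (1 / sqrt 2) *\<^sub>R (A - B + mat 1)"
    and V: "V = (1 / sqrt 2) *\<^sub>R (A + B + mat 1)"
    and W: "W = B - mat 1"
    and Qt: "pos_def Qt"
    and M: "pos_def M"
    and a: "2 *\<^sub>R (U ** Qt ** U\<^sup>\<dagger> + B ** Qt ** B\<^sup>\<dagger>) \<prec> Qt"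
    and b: "2 *\<^sub>R (V ** Qt ** V\<^sup>\<dagger> + W ** Qt ** W\<^sup>\<dagger>) \<prec> Qt"
    and c: "U\<^sup>\<dagger> ** M ** U + B\<^sup>\<dagger> ** M ** B \<prec> M - (V\<^sup>\<dagger> ** M ** V + W\<^sup>\<dagger> ** M ** W)"
    and d: "Q \<in> loewner_ointerval (U\<^sup>\<dagger> ** M ** U + B\<^sup>\<dagger> ** M ** B)
                                  (M - (V\<^sup>\<dagger> ** M ** V + W\<^sup>\<dagger> ** M ** W))"
  shows "(\<exists>!X. pos_def X \<and> A\<^sup>\<dagger> ** X ** B + B\<^sup>\<dagger> ** X ** A = - Q) \<and>
    (\<forall>Xhat. pos_def Xhat \<and> A\<^sup>\<dagger> ** Xhat ** B + B\<^sup>\<dagger> ** Xhat ** A = - Q \<longrightarrow>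
      Xhat \<in> loewner_cinterval (Q - (U\<^sup>\<dagger> ** M ** U + B\<^sup>\<dagger> ** M ** B))
                               (Q + (V\<^sup>\<dagger> ** M ** V + W\<^sup>\<dagger> ** M ** W)) \<and>
      (\<forall>X Y :: nat \<Rightarrow> complex^'n^'n.
        X 0 = 0 \<and> Y 0 = M \<and>
        (\<forall>n. X (Suc n) = Q + (V\<^sup>\<dagger> ** X n ** V + W\<^sup>\<dagger> ** X n ** W)
                           - (U\<^sup>\<dagger> ** Y n ** U + B\<^sup>\<dagger> ** Y n ** B)) \<and>
        (\<forall>n. Y (Suc n) = Q + (V\<^sup>\<dagger> ** Y n ** V + W\<^sup>\<dagger> ** Y n ** W)
                           - (U\<^sup>\<dagger> ** X n ** U + B\<^sup>\<dagger> ** X n ** B)) \<longrightarrow>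
        (\<lambda>n. spectral_norm (X n - Xhat)) \<longlonglongrightarrow> 0 \<and>
        (\<lambda>n. spectral_norm (Y n - Xhat)) \<longlonglongrightarrow> 0 \<and>
        (\<exists>\<delta>::real. 0 < \<delta> \<and> \<delta> < 1 \<and>
          (\<forall>n. max (spectral_norm (X n - Xhat)) (spectral_norm (Y n - Xhat))
                 \<le> \<delta> ^ n / (1 - \<delta>) *
                   max (spectral_norm (X 1 - X 0)) (spectral_norm (Y 1 - Y 0))))))"
proof -
  let ?P = "cong_sum V W" and ?R = "cong_sum U B"
  have hQ: "hermitian Q" and hM: "hermitian M" using Q M by (auto simp: pos_def_form)
  have c': "pos_def (M - (?P M + ?R M))"
    using c by (simp add: loewner_less_def cong_sum_def algebra_simps)
  have lower: "pos_def (Q - ?R M)" and upper: "pos_def (M - ?P M - Q)"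
    using d by (simp_all add: loewner_ointerval_def loewner_less_def cong_sum_def)
  obtain \<delta> where \<delta>: "0 < \<delta>" "\<delta> < 1"
    "\<And>x. x \<bullet> ((?P M + ?R M) *v x) \<le> \<delta> * (x \<bullet> (M *v x))"
    using pos_def_contraction_factor[OF M c'] by blast
  interpret dominated_cong_sums U B V W M \<delta>
    using M \<delta> by unfold_locales
  have eqn: "A\<^sup>\<dagger> ** X ** B + B\<^sup>\<dagger> ** X ** A = - Q \<longleftrightarrow> X = Q + ?P X - ?R X" for X
    using fixed_point_form[OF U V W, of X] by (auto simp: algebra_simps eq_neg_iff_add_eq_0)
  have between: "0 \<le> x \<bullet> (X *v x)" "x \<bullet> (X *v x) \<le> x \<bullet> (M *v x)"
    if "X = Q + ?P X - ?R X" for X x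
    using solution_between[OF that] pos_def_form_nonneg[OF lower] pos_def_form_nonneg[OF upper]
    by (simp_all add: form_linear)
  have below: "x \<bullet> ((Q - ?R M) *v x) \<le> x \<bullet> (X *v x)"
    and above: "x \<bullet> (X *v x) \<le> x \<bullet> ((Q + ?P M) *v x)"
    if "X = Q + ?P X - ?R X" for X x
  proof -
    \<comment> \<open>Since 0 \<le> X \<le> M, the \<open>P\<close> term lies between 0 and that of
      \<open>P M\<close>, and the \<open>R\<close> term between 0 and that of
      \<open>R M\<close>.\<close>
    have "x \<bullet> (X *v x) = x \<bullet> (Q *v x) + x \<bullet> (?P X *v x) - x \<bullet> (?R X *v x)"
      by (subst that) (simp add: form_linear)
    then show "x \<bullet> ((Q - ?R M) *v x) \<le> x \<bullet> (X *v x)" "x \<bullet> (X *v x) \<le> x \<bullet> ((Q + ?P M) *v x)"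
      using between[OF that, of "V *v x"] between[OF that, of "W *v x"]
        between[OF that, of "U *v x"] between[OF that, of "B *v x"]
      by (auto simp: form_linear cong_sum_form)
  qed
  have unique: "\<exists>!X. pos_def X \<and> X = Q + ?P X - ?R X"
  proof (rule ex_ex1I)
    obtain X where X: "hermitian X" "X = Q + ?P X - ?R X"
      using hermitian_solution_exists[OF hQ] by blast
    \<comment> \<open>Strict positivity comes from X \<ge> Q - R M, which is positive definite by
      (d).\<close>
    have "pos_def X"
      using X(1) below[OF X(2)] lower by (auto simp: pos_def_form intro: less_le_trans)
    with X show "\<exists>X. pos_def X \<and> X = Q + ?P X - ?R X" by blast
  qed (use hermitian_solution_unique[of _ _ Q] in \<open>auto simp: pos_def_form\<close>)
  have interval: "X \<in> loewner_cinterval (Q - ?R M) (Q + ?P M)"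
    if "pos_def X" "X = Q + ?P X - ?R X" for X
    using that(1) below[OF that(2)] above[OF that(2)] hQ hM
    by (simp add: loewner_cinterval_def loewner_le_def pos_def_form pos_semidef_form
        hermitian_add hermitian_diff hermitian_cong_sum form_linear)
  have limits: "(\<lambda>n. spectral_norm (X n - Xhat)) \<longlonglongrightarrow> 0 \<and> (\<lambda>n. spectral_norm (Y n - Xhat)) \<longlonglongrightarrow> 0 \<and>
      (\<exists>\<delta>::real. 0 < \<delta> \<and> \<delta> < 1 \<and>
        (\<forall>n. max (spectral_norm (X n - Xhat)) (spectral_norm (Y n - Xhat))
          \<le> \<delta> ^ n / (1 - \<delta>) * max (spectral_norm (X 1 - X 0)) (spectral_norm (Y 1 - Y 0))))"
    if Xhat: "pos_def Xhat" "Xhat = Q + ?P Xhat - ?R Xhat"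
      and XY: "X 0 = 0 \<and> Y 0 = M \<and> (\<forall>n. X (Suc n) = Q + ?P (X n) - ?R (Y n)) \<and>
        (\<forall>n. Y (Suc n) = Q + ?P (Y n) - ?R (X n))"
    for Xhat and X Y :: "nat \<Rightarrow> complex^'n^'n"
  proof -
    obtain C where C: "0 < C" "\<And>n. spectral_norm (X n - Xhat) \<le> C * \<delta> ^ n"
      "\<And>n. spectral_norm (Y n - Xhat) \<le> C * \<delta> ^ n"
      using coupled_iteration_spectral_norm[of Q Xhat X Y] hQ hM hermitian_0 Xhat XY
      by (auto simp: pos_def_form)
    have lim: "(\<lambda>n. C * \<delta> ^ n) \<longlonglongrightarrow> 0"
      using power_tendsto_0[of C] by (simp add: mult.commute)
    \<comment> \<open>Because \<open>X 0 = 0\<close> and \<open>Y 0 = M\<close>, the first increment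
      is positive definite, so the right side of the estimate is positive and \<open>C\<close> can
      be absorbed at the price of a rate \<epsilon> closer to 1.\<close>
    have "X 1 - X 0 = Q - ?R M" using XY by (simp add: cong_sum_def)
    then have "0 < max (spectral_norm (X 1 - X 0)) (spectral_norm (Y 1 - Y 0))"
      using pos_def_spectral_norm_pos[OF lower] by simp
    then obtain \<epsilon> where "0 < \<epsilon>" "\<epsilon> < 1" "\<And>n. C * \<delta> ^ n \<le>
        \<epsilon> ^ n / (1 - \<epsilon>) * max (spectral_norm (X 1 - X 0)) (spectral_norm (Y 1 - Y 0))"
      using geometric_bound_absorb_constant[OF \<delta>(1,2)] by blast
    moreover have "(\<lambda>n. spectral_norm (X n - Xhat)) \<longlonglongrightarrow> 0" "(\<lambda>n. spectral_norm (Y n - Xhat)) \<longlonglongrightarrow> 0"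
      by (rule tendsto_sandwich[OF _ _ tendsto_const lim]; simp add: spectral_norm_nonneg C)+
    ultimately show ?thesis using C by (meson max.boundedI order_trans)
  qed
  show ?thesis
    \<comment> \<open>The equation is first put in fixed point form; then \<open>cong_sum\<close> is
      expanded to match the explicit sums of the statement.\<close>
    unfolding eqn unfolding cong_sum_def
    by (rule conjI[OF unique[unfolded cong_sum_def]], intro allI impI, elim conjE,
        rule conjI[OF interval[unfolded cong_sum_def]], assumption+, intro allI impI,
        rule limits[unfolded cong_sum_def], assumption+)
qed

end
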